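(* Let $X$ be a real normed space and $K\subset X$ a closed convex pointed cone which is solid, i.e. $\operatorname{int}K\neq\emptyset$. Let $A,B\subset X$ be nonempty sets such that $B$ is $K$-compact, and let $e\in\operatorname{int}K$. If $$A\not\subset B+K,$$ then there is $\rho>0$ such that for every nonempty set $C\subset X$ which is weakly $K$-compact and satisfies $C\subset(\rho e-K)\cap(-\rho e+K)$ one has $$A+C\not\subset C+B+K.$$
   Context: Sums of sets are Minkowski sums; $\operatorname{int}$ is the norm-topological interior. A cone $K$ is pointed if $K\cap(-K)=\{0\}$. A nonempty set $S\subset X$ is called $K$-compact (respectively, weakly $K$-compact) if from every cover of $S$ by sets of the form $U+K$, with $U\subset X$ open in the norm topology (respectively, weakly open), one can extract a finite subcover. *)

theory Defs
  imports "HOL-Analysis.Analysis"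
begin

text \<open>On \<open>'a set\<close>, \<open>+\<close> is the Minkowski sum (from \<open>Set_Algebras\<close>), but \<open>-\<close> is set difference
  or complement; the set \<open>-K\<close> is therefore written \<open>uminus ` K\<close>.\<close>

definition pointed :: "'a::real_vector set \<Rightarrow> bool" where
  "pointed K \<longleftrightarrow> K \<inter> uminus ` K = {0}"

definition weak_topology :: "'a::real_normed_vector topology" where
  "weak_topology = topology_generated_by
     {f -` U | (f :: 'a \<Rightarrow> real) U. bounded_linear f \<and> open U}"

text \<open>The zero functional makes the whole space a subbasic set.\<close>

lemma topspace_weak_topology [simp]:
  "topspace (weak_topology :: 'a::real_normed_vector topology) = UNIV"
proof -
  have "(\<lambda>x::'a. 0::real) -` UNIV
      \<in> {f -` U | (f :: 'a \<Rightarrow> real) U. bounded_linear f \<and> open U}"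
    using bounded_linear_zero open_UNIV by blast
  then show ?thesis
    unfolding weak_topology_def topology_generated_by_topspace by auto
qed

definition cone_compactin :: "'a::real_vector topology \<Rightarrow> 'a set \<Rightarrow> 'a set \<Rightarrow> bool" where
  "cone_compactin T K S \<longleftrightarrow> S \<noteq> {} \<and>
     (\<forall>\<C>. \<C> \<subseteq> {U + K | U. openin T U} \<and> S \<subseteq> \<Union>\<C> \<longrightarrow>
        (\<exists>\<D>. finite \<D> \<and> \<D> \<subseteq> \<C> \<and> S \<subseteq> \<Union>\<D>))"

abbreviation K_compact :: "'a::real_normed_vector set \<Rightarrow> 'a set \<Rightarrow> bool" where
  "K_compact K S \<equiv> cone_compactin euclidean K S"

abbreviation weakly_K_compact :: "'a::real_normed_vector set \<Rightarrow> 'a set \<Rightarrow> bool" where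
  "weakly_K_compact K S \<equiv> cone_compactin weak_topology K S"

end

theory Submission
  imports Defs
begin

text \<open>Any relation \<open>a + c = c' + b + k\<close> with \<open>c, c'\<close> in the order interval \<open>[-\<rho>e, \<rho>e]\<close> yields
  \<open>a + 2\<rho>e \<in> B + K\<close>. As \<open>B + K\<close> is closed, this fails for small \<open>\<rho>\<close> once \<open>a \<notin> B + K\<close>.\<close>

text \<open>If x lies outside \<open>B + K\<close>, then each \<open>x - b\<close> has a ball
  missing \<open>K\<close>, with radius depending on b. Cone compactness of \<open>B\<close> reduces
  these radii to finitely many, which gives one neighbourhood of x that works for all b at
  once.\<close>

lemma closed_plus_K_compact:
  fixes K B :: "'a::real_normed_vector set"
  assumes "closed K" and add: "\<And>x y. x \<in> K \<Longrightarrow> y \<in> K \<Longrightarrow> x + y \<in> K" and "0 \<in> K"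
    and "K_compact K B"
  shows "closed (B + K)"
  unfolding closed_def
proof (subst open_subopen, intro ballI)
  fix x assume "x \<in> - (B + K)"
  then have "x - b \<in> - K" if "b \<in> B" for b
    using that set_plus_intro[of b B "x - b" K] by auto
  moreover have "open (- K)" using \<open>closed K\<close> by (simp add: open_Compl)
  ultimately have "\<exists>r>0. ball (x - b) r \<subseteq> - K" if "b \<in> B" for b
    using that open_contains_ball by blast
  then obtain r where r: "\<And>b. b \<in> B \<Longrightarrow> r b > 0 \<and> ball (x - b) (r b) \<subseteq> - K"
    by metis
  \<comment> \<open>The radius is halved to leave room for two displacements: half of
    \<open>r b\<close> for replacing the centre b by a nearby point, half for moving x.\<close>
  define V where "V b = ball b (r b / 2) + K" for b
  have "V ` B \<subseteq> {U + K | U. openin euclidean U}"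
    unfolding V_def by auto
  moreover have "B \<subseteq> \<Union> (V ` B)"
  proof
    fix b assume "b \<in> B"
    then have "b \<in> V b"
      using r[of b] set_plus_intro[of b "ball b (r b / 2)" 0 K] \<open>0 \<in> K\<close> by (simp add: V_def)
    then show "b \<in> \<Union> (V ` B)" using \<open>b \<in> B\<close> by blast
  qed
  ultimately obtain \<D> where "finite \<D>" "\<D> \<subseteq> V ` B" "B \<subseteq> \<Union>\<D>"
    using \<open>K_compact K B\<close> unfolding cone_compactin_def by meson
  then obtain F where F: "finite F" "F \<subseteq> B" "B \<subseteq> \<Union> (V ` F)"
    by (metis finite_subset_image)
  \<comment> \<open>Finiteness of \<open>F\<close> is what keeps this intersection open.\<close>
  let ?T = "\<Inter>b\<in>F. ball x (r b / 2)"
  have "open ?T" using F by auto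
  moreover have "x \<in> ?T" using F r by force
  moreover have "?T \<subseteq> - (B + K)"
  proof
    fix y assume y: "y \<in> ?T"
    show "y \<in> - (B + K)"
    proof
      assume "y \<in> B + K"
      then obtain b k where "b \<in> B" "k \<in> K" "y = b + k" by (auto elim: set_plus_elim)
      \<comment> \<open>The given b need not be near any centre: it is a point u near some f,
        shifted by l in \<open>K\<close>. The shift is absorbed into the cone, since y - u = l + k,
        so it suffices to compare y - u with x - f, whose ball of radius \<open>r f\<close> avoids
        \<open>K\<close>.\<close>
      then obtain f u l where "f \<in> F" "dist f u < r f / 2" "l \<in> K" "b = u + l"
        using F by (fastforce simp: V_def elim: set_plus_elim)
      then have "y - u \<in> K" using add \<open>k \<in> K\<close> \<open>y = b + k\<close> by (simp add: add.assoc)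
      have "dist (x - f) (y - u) = norm ((x - y) - (f - u))"
        by (simp add: dist_norm algebra_simps)
      also have "\<dots> \<le> dist x y + dist f u"
        unfolding dist_norm by (rule norm_triangle_ineq4)
      also have "\<dots> < r f / 2 + r f / 2"
        using y \<open>f \<in> F\<close> \<open>dist f u < r f / 2\<close> by (intro add_strict_mono) auto
      finally have "y - u \<in> ball (x - f) (r f)" by simp
      then show False using r[of f] F \<open>f \<in> F\<close> \<open>y - u \<in> K\<close> by blast
    qed
  qed
  ultimately show "\<exists>T. open T \<and> x \<in> T \<and> T \<subseteq> - (B + K)" by blast
qed

theorem proposition2p15:
  fixes K A B :: "'a::real_normed_vector set" and e :: 'a
  assumes "closed K" and "convex K" and "cone K" and "pointed K" and "interior K \<noteq> {}"
    and "A \<noteq> {}" and "B \<noteq> {}" and "K_compact K B"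
    and "e \<in> interior K"
    and "\<not> A \<subseteq> B + K"
  shows "\<exists>\<rho>>0. \<forall>C. C \<noteq> {} \<and> weakly_K_compact K C
           \<and> C \<subseteq> ({\<rho> *\<^sub>R e} + uminus ` K) \<inter> ({- (\<rho> *\<^sub>R e)} + K)
           \<longrightarrow> \<not> A + C \<subseteq> C + B + K"
proof -
  have add: "x + y \<in> K" if "x \<in> K" "y \<in> K" for x y
    using \<open>convex K\<close> \<open>cone K\<close> that convex_cone by blast
  have "0 \<in> K" using \<open>pointed K\<close> unfolding pointed_def by blast
  obtain a where a: "a \<in> A" "a \<notin> B + K" using \<open>\<not> A \<subseteq> B + K\<close> by blast
  have "open (- (B + K))"
    using closed_plus_K_compact[OF \<open>closed K\<close> add \<open>0 \<in> K\<close> \<open>K_compact K B\<close>] by (simp add: open_Compl)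
  then obtain d where d: "d > 0" "ball a d \<subseteq> - (B + K)"
    using a open_contains_ball by blast
  \<comment> \<open>Chosen so that 2\<rho> times the norm of e stays strictly below d; adding 1
    gives strictness and a nonzero denominator even for e = 0.\<close>
  define \<rho> where "\<rho> = d / (2 * (norm e + 1))"
  have pos: "norm e + 1 > 0" by (simp add: add_nonneg_pos)
  have "\<rho> > 0" using d pos by (simp add: \<rho>_def)
  have "2 * \<rho> * norm e < 2 * \<rho> * (norm e + 1)" using \<open>\<rho> > 0\<close> by simp
  also have "\<dots> = d" using pos by (simp add: \<rho>_def field_simps)
  finally have "a + (2 * \<rho>) *\<^sub>R e \<in> ball a d" using \<open>\<rho> > 0\<close> by (simp add: dist_norm)
  then have notin: "a + (2 * \<rho>) *\<^sub>R e \<notin> B + K" using d by blast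
  have "\<not> A + C \<subseteq> C + B + K"
    if C: "C \<noteq> {}" "C \<subseteq> ({\<rho> *\<^sub>R e} + uminus ` K) \<inter> ({- (\<rho> *\<^sub>R e)} + K)" for C
  proof
    assume sub: "A + C \<subseteq> C + B + K"
    obtain c where "c \<in> C" using C by blast
    then have "a + c \<in> C + B + K" using sub a set_plus_intro by blast
    then obtain c' b k where c': "c' \<in> C" "b \<in> B" "k \<in> K" "a + c = c' + b + k"
      by (auto elim!: set_plus_elim)
    from \<open>c \<in> C\<close> C have "c \<in> {\<rho> *\<^sub>R e} + uminus ` K" by blast
    then obtain k1 where k1: "k1 \<in> K" "c = \<rho> *\<^sub>R e - k1" by (auto elim!: set_plus_elim)
    from \<open>c' \<in> C\<close> C have "c' \<in> {- (\<rho> *\<^sub>R e)} + K" by blast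
    then obtain k2 where k2: "k2 \<in> K" "c' = - (\<rho> *\<^sub>R e) + k2" by (auto elim!: set_plus_elim)
    \<comment> \<open>The upper bound \<rho>e is used for c, which is subtracted, and the lower
      bound -\<rho>e for c', which is added. Hence k1 and k2 both enter with a plus sign, and the
      multiples of e combine to -2\<rho>e, which moves to the left-hand side.\<close>
    have "a = c' + b + k - c" using c'(4) by (metis add_diff_cancel_right')
    then have "a + (2 * \<rho>) *\<^sub>R e = b + (k + k1 + k2)"
      using k1 k2 by (simp add: algebra_simps flip: scaleR_2)
    moreover have "k + k1 + k2 \<in> K" using add c' k1 k2 by blast
    ultimately show False using notin c' set_plus_intro by metis
  qed
  then show ?thesis using \<open>\<rho> > 0\<close> by blast
qed

end
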